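(* Let $\mathcal{M}=(E,\mathcal{B})$ be a matroid of rank $k$, and let $S\sim T$ be any two adjacent bases of $\mathcal{M}$, with $S\setminus T=\{s\}$ and $T\setminus S=\{t\}$. Let $J=\{u\in S: t\in N(S-u),\ u\ne s\}$, and for $u\in J$ let $A_u=(N(S-u)\setminus\{t\})\setminus N(T-u)$. Then the Ollivier--Ricci curvature $\kappa$ of the basis exchange walk on $\mathcal{M}$ satisfies \[\kappa \leq \frac{1}{k} + \frac{1}{k}\sum_{u\in J}\left(\frac{1}{\#N(T-u)} - \frac{\#A_u}{\#N(S-u)}\right).\]
   Context: A matroid $\mathcal{M}=(E,\mathcal{B})$ is a finite set $E$ with a non-empty collection $\mathcal{B}$ of subsets (bases) such that no proper subset of a basis is a basis and the basis exchange property holds; its rank $k$ is the common size of its bases, and we assume $k\ge 1$ so that the walk below is defined. We write $B-u$ for $B\setminus\{u\}$ and $B+x$ for $B\cup\{x\}$. For a basis $B$ and $u\in B$, $N(B-u)=\{x\in E: B-u+x \text{ is a basis}\}$. Bases $S,T$ are adjacent, written $S\sim T$, if $d(S,T)=1$ for the metric below, i.e. $T=S-s+t$ for some $s\in S$, $t\notin S$. The basis exchange walk (down-up walk) on $\mathcal{M}$ is the Markov chain $P$ on $\mathcal{B}$ that from $S\in\mathcal{B}$ drops an element $u\in S$ chosen uniformly at random, then moves to a uniformly random basis containing $S-u$ (possibly $S$ itself). The metric on $\mathcal{B}$ is $d(S,T)=\inf\{t\ge 0: P^t(S,T)>0\}$. The Wasserstein distance is $\mathcal{W}(\mu,\nu)=\min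 \mathbb{E}\, d(X,Y)$, the minimum being over all couplings $(X,Y)$ of $X\sim\mu$ and $Y\sim\nu$. The Ollivier--Ricci curvature $\kappa$ of $P$ is the largest $\kappa$ such that $\mathcal{W}(P(S,\cdot),P(T,\cdot))\le(1-\kappa)\,d(S,T)$ for all $S,T\in\mathcal{B}$, i.e. $\kappa=\inf_{S\ne T}\left(1-\mathcal{W}(P(S,\cdot),P(T,\cdot))/d(S,T)\right)$. *)

theory Defs
  imports "HOL-Probability.Probability"
begin

locale matroid =
  fixes E :: "'a set" and \<B> :: "'a set set"
  assumes finite_ground: "finite E"
    and bases_subset: "\<B> \<subseteq> Pow E"
    and bases_nonempty: "\<B> \<noteq> {}"
    and no_proper_subset: "B \<in> \<B> \<Longrightarrow> A \<subset> B \<Longrightarrow> A \<notin> \<B>"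
    and basis_exchange:
      "A \<in> \<B> \<Longrightarrow> B \<in> \<B> \<Longrightarrow> a \<in> A - B \<Longrightarrow> \<exists>b \<in> B - A. insert b (A - {a}) \<in> \<B>"

(* The description is proper for a matroid: see card_basis_eq_rank below. *)
definition matroid_rank :: "'a set set \<Rightarrow> nat" where
  "matroid_rank \<B> = (THE k. \<forall>B\<in>\<B>. card B = k)"

(* N(B - u) is completions E \<B> (B - {u}); it contains u itself. *)
definition completions :: "'a set \<Rightarrow> 'a set set \<Rightarrow> 'a set \<Rightarrow> 'a set" where
  "completions E \<B> I = {x \<in> E. insert x I \<in> \<B>}"

(* One step of the walk from S. As pmf_of_set is unspecified on the empty set and on infinite
   sets, this is meaningful when S is a non-empty basis of a matroid. *)
definition exchange_walk :: "'a set set \<Rightarrow> 'a set \<Rightarrow> 'a set pmf" where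
  "exchange_walk \<B> S =
     bind_pmf (pmf_of_set S) (\<lambda>u. pmf_of_set {B \<in> \<B>. S - {u} \<subseteq> B})"

primrec walk_power :: "'a set set \<Rightarrow> nat \<Rightarrow> 'a set \<Rightarrow> 'a set pmf" where
  "walk_power \<B> 0 S = return_pmf S"
| "walk_power \<B> (Suc n) S = bind_pmf (walk_power \<B> n S) (exchange_walk \<B>)"

(* An infimum of natural numbers. The set is never empty for bases of a matroid of positive
   rank (see walk_irreducible below), so the convention Inf {} = 0 plays no role. *)
definition basis_dist :: "'a set set \<Rightarrow> 'a set \<Rightarrow> 'a set \<Rightarrow> nat" where
  "basis_dist \<B> S T = Inf {n. pmf (walk_power \<B> n S) T > 0}"

definition adjacent_bases :: "'a set set \<Rightarrow> 'a set \<Rightarrow> 'a set \<Rightarrow> bool" where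
  "adjacent_bases \<B> S T \<longleftrightarrow> S \<in> \<B> \<and> T \<in> \<B> \<and> basis_dist \<B> S T = 1"

definition couplings :: "'b pmf \<Rightarrow> 'b pmf \<Rightarrow> ('b \<times> 'b) pmf set" where
  "couplings \<mu> \<nu> = {\<gamma>. map_pmf fst \<gamma> = \<mu> \<and> map_pmf snd \<gamma> = \<nu>}"

(* The infimum is attained when \<mu> and \<nu> have finite support, as all laws of the walk do. *)
definition wasserstein :: "('b \<Rightarrow> 'b \<Rightarrow> real) \<Rightarrow> 'b pmf \<Rightarrow> 'b pmf \<Rightarrow> real" where
  "wasserstein d \<mu> \<nu> =
     (INF \<gamma>\<in>couplings \<mu> \<nu>. measure_pmf.expectation \<gamma> (\<lambda>(x, y). d x y))"

(* The infimum is over a finite index set, which is non-empty as soon as there are two bases. *)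
definition ollivier_ricci_curvature :: "'a set set \<Rightarrow> real" where
  "ollivier_ricci_curvature \<B> =
     (INF (S, T)\<in>{(S, T). S \<in> \<B> \<and> T \<in> \<B> \<and> S \<noteq> T}.
        1 - wasserstein (\<lambda>X Y. real (basis_dist \<B> X Y)) (exchange_walk \<B> S) (exchange_walk \<B> T)
              / real (basis_dist \<B> S T))"

context matroid
begin

lemma finite_basis: "B \<in> \<B> \<Longrightarrow> finite B"
  using bases_subset finite_ground by (meson PowD finite_subset subsetD)

lemma finite_bases: "finite \<B>"
  using bases_subset finite_ground by (meson finite_Pow_iff finite_subset)

lemma card_bases_eq:
  assumes "A \<in> \<B>" "B \<in> \<B>"
  shows "card A = card B"
  using assms
proof (induction "card (A - B)" arbitrary: A)
  case 0
  then have "A \<subseteq> B" using finite_basis by auto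
  then show ?case using no_proper_subset 0 by blast
next
  case (Suc n)
  have "A - B \<noteq> {}" using Suc.hyps(2) by (metis card.empty nat.distinct(1))
  then obtain a where a: "a \<in> A - B" by blast
  obtain b where b: "b \<in> B - A" "insert b (A - {a}) \<in> \<B>"
    using basis_exchange[OF Suc.prems a] by blast
  have fin: "finite A" using finite_basis Suc.prems by blast
  have "insert b (A - {a}) - B = (A - B) - {a}" using b by blast
  then have "card (insert b (A - {a}) - B) = card (A - B) - 1" using a fin by simp
  then have n: "n = card (insert b (A - {a}) - B)" using Suc.hyps(2) by linarith
  have "card (insert b (A - {a})) = card B" using Suc.hyps(1)[OF n b(2) Suc.prems(2)] .
  moreover have "card (insert b (A - {a})) = card A"
    using a b(1) fin by (simp add: card_Suc_Diff1 del: card_Diff_insert)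
  ultimately show ?case by simp
qed

lemma card_basis_eq_rank:
  assumes "B \<in> \<B>"
  shows "card B = matroid_rank \<B>"
proof -
  have "matroid_rank \<B> = card B"
    unfolding matroid_rank_def
  proof (rule the_equality)
    show "\<forall>A\<in>\<B>. card A = card B" using card_bases_eq assms by blast
    show "k = card B" if "\<forall>A\<in>\<B>. card A = k" for k using bspec[OF that assms] by simp
  qed
  then show ?thesis by simp
qed

lemma set_pmf_exchange_walk:
  assumes "S \<in> \<B>" "S \<noteq> {}"
  shows "set_pmf (exchange_walk \<B> S) = (\<Union>u\<in>S. {B \<in> \<B>. S - {u} \<subseteq> B})"
proof -
  have "{B \<in> \<B>. S - {u} \<subseteq> B} \<noteq> {}" "finite {B \<in> \<B>. S - {u} \<subseteq> B}" for u
    using assms finite_bases by auto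
  then show ?thesis
    using assms finite_basis by (simp add: exchange_walk_def set_pmf_of_set)
qed

lemma walk_power_Suc_rev:
  "walk_power \<B> (Suc n) S = bind_pmf (exchange_walk \<B> S) (walk_power \<B> n)"
proof (induction n)
  case 0
  then show ?case by (simp add: bind_return_pmf bind_return_pmf')
next
  case (Suc n)
  have "walk_power \<B> (Suc (Suc n)) S = bind_pmf (walk_power \<B> (Suc n) S) (exchange_walk \<B>)"
    by simp
  also have "\<dots> = bind_pmf (exchange_walk \<B> S)
      (\<lambda>R. bind_pmf (walk_power \<B> n R) (exchange_walk \<B>))"
    by (simp only: Suc bind_assoc_pmf)
  finally show ?case by simp
qed

lemma walk_irreducible:
  assumes "matroid_rank \<B> \<ge> 1" "S \<in> \<B>" "T \<in> \<B>"
  shows "\<exists>n. pmf (walk_power \<B> n S) T > 0"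
  using assms(2)
proof (induction "card (S - T)" arbitrary: S)
  case 0
  then have "S \<subseteq> T" using finite_basis by auto
  then have "S = T" using no_proper_subset 0 assms by blast
  then have "pmf (walk_power \<B> 0 S) T > 0" by simp
  then show ?case by blast
next
  case (Suc n)
  have "S - T \<noteq> {}" using Suc.hyps(2) by (metis card.empty nat.distinct(1))
  then obtain a where a: "a \<in> S - T" by blast
  obtain b where b: "b \<in> T - S" "insert b (S - {a}) \<in> \<B>"
    using basis_exchange[OF Suc.prems assms(3) a] by blast
  let ?R = "insert b (S - {a})"
  have fin: "finite S" using finite_basis Suc.prems by blast
  have "?R - T = (S - T) - {a}" using b by blast
  then have "card (?R - T) = card (S - T) - 1" using a fin by simp
  then have n: "n = card (?R - T)" using Suc.hyps(2) by linarith
  obtain m where m: "pmf (walk_power \<B> m ?R) T > 0" using Suc.hyps(1)[OF n b(2)] by blast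
  have "?R \<in> set_pmf (exchange_walk \<B> S)"
    using a b Suc.prems by (subst set_pmf_exchange_walk) auto
  then have "T \<in> set_pmf (walk_power \<B> (Suc m) S)"
    using m unfolding walk_power_Suc_rev by (auto simp: pmf_positive_iff)
  then show ?case by (blast intro: pmf_positive)
qed

end

end

(* The bound comes from the easy direction of Kantorovich duality applied to a potential F on
   bases: F = 1 if t belongs to the basis B and s does not; F = -1 if s belongs to B, t does not,
   and B - s + t is not a basis; F = 0 otherwise. Values 1 and -1 are never taken at bases that
   differ by a single exchange, as this could only replace s by t; so F is 1-Lipschitz. Dropping
   s from S or t from T leads to the same law, and for every other u the mean of F after dropping
   u from T exceeds the one after dropping u from S by at least 1, corrected for u in J by
   - 1/#N(T-u) + #A_u/#N(S-u). *)
theory Submission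
  imports Defs
begin

section \<open>Lower bounds on the Wasserstein distance from potentials\<close>

lemma wasserstein_ge_potential:
  fixes d :: "'b \<Rightarrow> 'b \<Rightarrow> real" and F :: "'b \<Rightarrow> real"
  assumes fin: "finite (set_pmf \<mu>)" "finite (set_pmf \<nu>)"
    and lip: "\<And>x y. x \<in> set_pmf \<mu> \<Longrightarrow> y \<in> set_pmf \<nu> \<Longrightarrow> F y - F x \<le> d x y"
  shows "measure_pmf.expectation \<nu> F - measure_pmf.expectation \<mu> F \<le> wasserstein d \<mu> \<nu>"
  unfolding wasserstein_def
proof (rule cINF_greatest)
  have "pair_pmf \<mu> \<nu> \<in> couplings \<mu> \<nu>"
    by (simp add: couplings_def map_fst_pair_pmf map_snd_pair_pmf)
  then show "couplings \<mu> \<nu> \<noteq> {}" by blast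
next
  fix \<gamma> assume "\<gamma> \<in> couplings \<mu> \<nu>"
  then have \<mu>: "map_pmf fst \<gamma> = \<mu>" and \<nu>: "map_pmf snd \<gamma> = \<nu>"
    by (auto simp: couplings_def)
  have sub: "set_pmf \<gamma> \<subseteq> set_pmf \<mu> \<times> set_pmf \<nu>"
    unfolding \<mu>[symmetric] \<nu>[symmetric] by (auto intro: rev_image_eqI)
  then have "finite (set_pmf \<gamma>)"
    using fin finite_subset by blast
  then have int: "integrable (measure_pmf \<gamma>) h" for h :: "'b \<times> 'b \<Rightarrow> real"
    by (rule integrable_measure_pmf_finite)
  have "measure_pmf.expectation \<nu> F - measure_pmf.expectation \<mu> F
      = measure_pmf.expectation \<gamma> (\<lambda>z. F (snd z)) - measure_pmf.expectation \<gamma> (\<lambda>z. F (fst z))"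
    unfolding \<mu>[symmetric] \<nu>[symmetric] by simp
  also have "\<dots> = measure_pmf.expectation \<gamma> (\<lambda>z. F (snd z) - F (fst z))"
    by (rule Bochner_Integration.integral_diff[OF int int, symmetric])
  also have "\<dots> \<le> measure_pmf.expectation \<gamma> (\<lambda>(x, y). d x y)"
    \<comment> \<open>The bound \<open>lip\<close> applies almost surely, as \<open>\<gamma>\<close>
      only charges pairs from the two supports.\<close>
    by (rule integral_mono_AE[OF int int]) (use sub lip in \<open>auto simp: AE_measure_pmf_iff\<close>)
  finally show "measure_pmf.expectation \<nu> F - measure_pmf.expectation \<mu> F
      \<le> measure_pmf.expectation \<gamma> (\<lambda>(x, y). d x y)" .
qed

context matroid
begin

section \<open>One step of the walk in terms of completions\<close>

lemma finite_completions: "finite (completions E \<B> I)"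
  using finite_ground by (simp add: completions_def)

text \<open>Adding an element already present would make \<open>B - {u}\<close> a basis properly
  inside \<open>B\<close>. This gives injectivity of \<open>insert x (B - {u})\<close> in
  \<open>x\<close>.\<close>

lemma completions_disjoint:
  assumes "B \<in> \<B>" "u \<in> B"
  shows "completions E \<B> (B - {u}) \<inter> (B - {u}) = {}"
proof -
  have "B - {u} \<notin> \<B>" using assms no_proper_subset[of B "B - {u}"] by blast
  then show ?thesis using insert_absorb[of _ "B - {u}"]
    by (fastforce simp: completions_def)
qed

lemma self_in_completions:
  assumes "B \<in> \<B>" "u \<in> B"
  shows "u \<in> completions E \<B> (B - {u})"
  using assms bases_subset by (auto simp: completions_def insert_absorb)

text \<open>Bases are equicardinal, so one containing \<open>B - {u}\<close> has exactly one further
  element. A uniform basis above \<open>B - {u}\<close> thus amounts to a uniform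
  completion.\<close>

lemma bases_above_eq_image:
  assumes "B \<in> \<B>" "u \<in> B"
  shows "{A \<in> \<B>. B - {u} \<subseteq> A} = (\<lambda>x. insert x (B - {u})) ` completions E \<B> (B - {u})"
proof (intro equalityI subsetI)
  fix A assume "A \<in> {A \<in> \<B>. B - {u} \<subseteq> A}"
  then have A: "A \<in> \<B>" "B - {u} \<subseteq> A" by auto
  have "card A = Suc (card (B - {u}))"
    using card_bases_eq[OF A(1) assms(1)] finite_basis[OF assms(1)] assms(2)
    by (metis card_Suc_Diff1)
  then have "card (A - (B - {u})) = 1"
    using A(2) finite_basis[OF assms(1)] by (simp add: card_Diff_subset)
  then obtain x where "A - (B - {u}) = {x}" by (auto simp: card_1_singleton_iff)
  then have x: "A = insert x (B - {u})" using A(2) by blast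
  then have "x \<in> completions E \<B> (B - {u})"
    using A(1) bases_subset by (auto simp: completions_def)
  with x show "A \<in> (\<lambda>x. insert x (B - {u})) ` completions E \<B> (B - {u})" by blast
qed (auto simp: completions_def)

lemma expectation_exchange_walk:
  fixes F :: "'a set \<Rightarrow> real"
  assumes "B \<in> \<B>" "B \<noteq> {}"
  shows "measure_pmf.expectation (exchange_walk \<B> B) F
    = (\<Sum>u\<in>B. (\<Sum>x\<in>completions E \<B> (B - {u}). F (insert x (B - {u})))
                / card (completions E \<B> (B - {u}))) / card B"
proof -
  let ?U = "\<lambda>u. {A \<in> \<B>. B - {u} \<subseteq> A}"
  have U: "?U u \<noteq> {}" "finite (?U u)" for u
    using assms finite_bases by auto
  have "measure_pmf.expectation (exchange_walk \<B> B) F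
      = (\<Sum>u\<in>B. measure_pmf.expectation (pmf_of_set (?U u)) F) / card B"
    unfolding exchange_walk_def using assms U finite_basis
    by (subst pmf_expectation_bind_pmf_of_set)
      (auto simp: divide_inverse sum_distrib_left mult.commute)
  also have "(\<Sum>u\<in>B. measure_pmf.expectation (pmf_of_set (?U u)) F)
      = (\<Sum>u\<in>B. (\<Sum>x\<in>completions E \<B> (B - {u}). F (insert x (B - {u})))
                / card (completions E \<B> (B - {u})))"
  proof (rule sum.cong[OF refl])
    fix u assume "u \<in> B"
    let ?h = "\<lambda>x. insert x (B - {u})"
    have "inj_on ?h (completions E \<B> (B - {u}))"
      using completions_disjoint[OF assms(1) \<open>u \<in> B\<close>] by (auto simp: inj_on_def)
    then show "measure_pmf.expectation (pmf_of_set (?U u)) F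
        = (\<Sum>x\<in>completions E \<B> (B - {u}). F (?h x)) / card (completions E \<B> (B - {u}))"
      unfolding integral_pmf_of_set[OF U]
      unfolding bases_above_eq_image[OF assms(1) \<open>u \<in> B\<close>]
      by (simp add: sum.reindex card_image)
  qed
  finally show ?thesis .
qed

section \<open>Small values of the distance\<close>

lemma walk_power_basis_dist:
  assumes "matroid_rank \<B> \<ge> 1" "X \<in> \<B>" "Y \<in> \<B>"
  shows "Y \<in> set_pmf (walk_power \<B> (basis_dist \<B> X Y) X)"
proof -
  \<comment> \<open>Irreducibility makes the set of times non-empty, so its infimum is
    attained.\<close>
  have "basis_dist \<B> X Y \<in> {n. pmf (walk_power \<B> n X) Y > 0}"
    unfolding basis_dist_def using walk_irreducible[OF assms] by (intro Inf_nat_def1) auto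
  then show ?thesis by (simp add: pmf_positive_iff)
qed

lemma basis_dist_pos:
  assumes "matroid_rank \<B> \<ge> 1" "X \<in> \<B>" "Y \<in> \<B>" "X \<noteq> Y"
  shows "basis_dist \<B> X Y \<ge> 1"
  using walk_power_basis_dist[OF assms(1-3)] assms(4) by (cases "basis_dist \<B> X Y") auto

lemma basis_dist_1D:
  assumes "matroid_rank \<B> \<ge> 1" "X \<in> \<B>" "Y \<in> \<B>" "basis_dist \<B> X Y = 1"
  shows "\<exists>u\<in>X. X - {u} \<subseteq> Y"
proof -
  have "X \<noteq> {}" using card_basis_eq_rank[OF assms(2)] assms(1) by auto
  moreover have "Y \<in> set_pmf (exchange_walk \<B> X)"
    using walk_power_basis_dist[OF assms(1-3)] assms(4) by (simp add: bind_return_pmf)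
  ultimately show ?thesis using set_pmf_exchange_walk[OF assms(2)] by auto
qed

section \<open>The potential and its Lipschitz bound\<close>

definition potential :: "'a \<Rightarrow> 'a \<Rightarrow> 'a set \<Rightarrow> real" where
  "potential s t B = (if t \<in> B \<and> s \<notin> B then 1
     else if s \<in> B \<and> t \<notin> B \<and> insert t (B - {s}) \<notin> \<B> then - 1 else 0)"

text \<open>The values are -1, 0 and 1, so at distance 1 only a jump from -1 to 1 could break the
  bound. The non-exchange condition in the branch for -1 excludes it.\<close>

lemma potential_lipschitz:
  assumes rank: "matroid_rank \<B> \<ge> 1" and X: "X \<in> \<B>" and Y: "Y \<in> \<B>"
  shows "potential s t Y - potential s t X \<le> basis_dist \<B> X Y"
proof (cases "X = Y")
  case False
  have pos: "basis_dist \<B> X Y \<ge> 1" using basis_dist_pos[OF rank X Y False] .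
  show ?thesis
  proof (cases "t \<in> Y \<and> s \<notin> Y \<and> s \<in> X \<and> t \<notin> X \<and> insert t (X - {s}) \<notin> \<B>")
    case True
    have "basis_dist \<B> X Y \<noteq> 1"
    proof
      assume "basis_dist \<B> X Y = 1"
      then obtain u where "u \<in> X" "X - {u} \<subseteq> Y" using basis_dist_1D[OF rank X Y] by blast
      \<comment> \<open>The dropped \<open>u\<close> must be \<open>s\<close>, which lies in
        \<open>X\<close> but not in \<open>Y\<close>.\<close>
      with True have "X - {s} \<subseteq> Y" by blast
      with Y have "Y \<in> {A \<in> \<B>. X - {s} \<subseteq> A}" by blast
      then obtain y where "Y = insert y (X - {s})"
        using bases_above_eq_image[OF X, of s] True by blast
      \<comment> \<open>Since \<open>t\<close> is in \<open>Y\<close> but not in \<open>X\<close>,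
        the added \<open>y\<close> is \<open>t\<close>, contradicting that this exchange gives no
        basis.\<close>
      with True Y show False by auto
    qed
    with pos have "basis_dist \<B> X Y \<ge> 2" by linarith
    moreover have "potential s t Y - potential s t X \<le> 2" by (simp add: potential_def)
    ultimately show ?thesis by linarith
  next
    case False
    then have "potential s t Y - potential s t X \<le> 1"
      by (auto simp: potential_def)
    with pos show ?thesis by linarith
  qed
qed simp

text \<open>Finiteness of the index set bounds the family below, so its real infimum is at most each
  member.\<close>

lemma curvature_le:
  assumes "S \<in> \<B>" "T \<in> \<B>" "S \<noteq> T"
  shows "ollivier_ricci_curvature \<B> \<le>
    1 - wasserstein (\<lambda>X Y. real (basis_dist \<B> X Y)) (exchange_walk \<B> S) (exchange_walk \<B> T)
          / real (basis_dist \<B> S T)"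
proof -
  have "finite {(S, T). S \<in> \<B> \<and> T \<in> \<B> \<and> S \<noteq> T}"
    by (rule finite_subset[of _ "\<B> \<times> \<B>"]) (use finite_bases in auto)
  then show ?thesis
    unfolding ollivier_ricci_curvature_def
    by (intro cINF_lower2[where x = "(S, T)"] bdd_below_finite finite_imageI)
      (use assms in auto)
qed

end

section \<open>Mean potentials after a drop, and the curvature bound\<close>

theorem theorem5p1:
  fixes E :: "'a set" and \<B> :: "'a set set" and k :: nat
    and S T J :: "'a set" and s t :: 'a and A :: "'a \<Rightarrow> 'a set"
  assumes "matroid E \<B>"
    and "k = matroid_rank \<B>" and "k \<ge> 1"
    and "adjacent_bases \<B> S T"
    and "S - T = {s}" and "T - S = {t}"
    and "J = {u \<in> S. t \<in> completions E \<B> (S - {u}) \<and> u \<noteq> s}"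
    and "\<And>u. u \<in> J \<Longrightarrow>
           A u = (completions E \<B> (S - {u}) - {t}) - completions E \<B> (T - {u})"
  shows "ollivier_ricci_curvature \<B> \<le>
    1 / real k + 1 / real k *
      (\<Sum>u\<in>J. 1 / real (card (completions E \<B> (T - {u})))
               - real (card (A u)) / real (card (completions E \<B> (S - {u}))))"
proof -
  interpret matroid E \<B> by (rule assms(1))
  let ?N = "completions E \<B>"
  let ?F = "potential s t"
  let ?P = "exchange_walk \<B>"
  let ?D = "\<lambda>X Y. real (basis_dist \<B> X Y)"
  define C where "C = S \<inter> T"
  have S: "S \<in> \<B>" and T: "T \<in> \<B>" and dist: "basis_dist \<B> S T = 1"
    using assms(4) by (auto simp: adjacent_bases_def)
  have rank: "matroid_rank \<B> \<ge> 1" using assms(2,3) by simp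
  have SC: "S = insert s C" "s \<notin> C" and TC: "T = insert t C" "t \<notin> C"
    and st: "s \<noteq> t" "t \<notin> S" "s \<notin> T"
    using assms(5,6) by (auto simp: C_def)
  have finC: "finite C" using finite_basis[OF S] by (simp add: C_def)
  have cardS: "card S = k" and cardT: "card T = k"
    using card_basis_eq_rank S T assms(2) by auto
  have k: "real k = 1 + real (card C)" using cardS SC finC by simp
  \<comment> \<open>The mean of the potential after one step from \<open>B\<close>, given that
    \<open>u\<close> is dropped.\<close>
  define mean where
    "mean B u = (\<Sum>x\<in>?N (B - {u}). ?F (insert x (B - {u}))) / card (?N (B - {u}))" for B u
  have expect: "measure_pmf.expectation (?P B) ?F = (\<Sum>u\<in>B. mean B u) / k" if "B = S \<or> B = T" for B
    unfolding mean_def using that S T SC TC cardS cardT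
    by (subst expectation_exchange_walk) auto
  have same: "mean S s = mean T t"
    using SC TC by (simp add: mean_def)
  have JC: "J \<subseteq> C" using assms(7) SC by auto
  have mean_T: "mean T u = 1 - (if u \<in> J then 1 / card (?N (T - {u})) else 0)" if u: "u \<in> C" for u
  proof -
    have ut: "u \<noteq> t" "u \<noteq> s" "u \<in> T" using u SC TC by auto
    \<comment> \<open>The exchanges \<open>T - u + s\<close> and \<open>S - u + t\<close> are the
      same set, so membership in \<open>J\<close> can be read off from \<open>T\<close>.\<close>
    have swap: "insert s (T - {u}) = insert t (S - {u})"
      using SC TC ut by auto
    have J_iff: "u \<in> J \<longleftrightarrow> s \<in> ?N (T - {u})"
    proof -
      have "s \<in> E" "t \<in> E" using S T SC TC bases_subset by auto
      then show ?thesis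
        using assms(7) u SC ut swap by (auto simp: completions_def)
    qed
    \<comment> \<open>\<open>T - {u}\<close> keeps \<open>t\<close> and lacks \<open>s\<close>; only
      adding \<open>s\<close> lowers the value from 1 to 0.\<close>
    have "?F (insert x (T - {u})) = 1 - (if x = s then 1 else 0)" for x
      using ut st TC by (auto simp: potential_def)
    then have "(\<Sum>x\<in>?N (T - {u}). ?F (insert x (T - {u})))
        = real (card (?N (T - {u}))) - (if u \<in> J then 1 else 0)"
      by (simp only: sum_subtractf J_iff) (simp add: finite_completions)
    \<comment> \<open>Needed for the quotient of the cardinality by itself to be 1, as division by
      zero yields 0.\<close>
    moreover have "card (?N (T - {u})) \<noteq> 0"
      using self_in_completions[OF T ut(3)] finite_completions by auto
    ultimately show ?thesis by (simp add: mean_def diff_divide_distrib)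
  qed
  \<comment> \<open>Outside \<open>J\<close> the set \<open>A u\<close> is unspecified; there the
    bound only says that the mean is not positive.\<close>
  have mean_S: "mean S u \<le> - (if u \<in> J then card (A u) / card (?N (S - {u})) else 0)"
    if u: "u \<in> C" for u
  proof -
    have us: "u \<noteq> s" "u \<noteq> t" using u SC TC by auto
    let ?A = "?N (S - {u}) - {t} - ?N (T - {u})"
    have F: "?F (insert x (S - {u})) = - (if x \<in> ?A then 1 else 0)" if x: "x \<in> ?N (S - {u})" for x
    proof (cases "x = t")
      case True
      then show ?thesis using us SC by (simp add: potential_def)
    next
      case False
      \<comment> \<open>In particular \<open>x\<close> is not \<open>s\<close>, so trading
        \<open>s\<close> for \<open>t\<close> leaves \<open>x\<close> in place and the result is a
        basis iff \<open>x\<close> completes \<open>T - {u}\<close>.\<close>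
      have "x \<notin> S - {u}" using completions_disjoint[OF S, of u] x u SC by blast
      then have "insert t (insert x (S - {u}) - {s}) = insert x (T - {u})"
        using SC TC us by auto
      moreover have "x \<in> E" using x by (simp add: completions_def)
      ultimately show ?thesis
        using False x st us SC by (auto simp: potential_def completions_def)
    qed
    have "(\<Sum>x\<in>?N (S - {u}). ?F (insert x (S - {u}))) = (\<Sum>x\<in>?N (S - {u}). - (if x \<in> ?A then 1 else 0))"
      by (rule sum.cong) (use F in auto)
    also have "\<dots> = - real (card ?A)"
    proof -
      have "?N (S - {u}) \<inter> ?A = ?A" by blast
      then show ?thesis
        unfolding sum_negf sum.inter_restrict[OF finite_completions, symmetric] by simp
    qed
    finally have "mean S u = - card ?A / card (?N (S - {u}))" by (simp add: mean_def)
    then show ?thesis using assms(8)[of u] by auto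
  qed
  define g where "g u = 1 / real (card (?N (T - {u})))
               - real (card (A u)) / real (card (?N (S - {u})))" for u
  define \<Sigma> where "\<Sigma> = sum g J"
  have "C \<inter> J = J" using JC by blast
  then have "real (card C) - \<Sigma> = (\<Sum>u\<in>C. 1 - (if u \<in> J then g u else 0))"
    unfolding \<Sigma>_def sum_subtractf sum.inter_restrict[OF finC, symmetric] by simp
  also have "\<dots> \<le> (\<Sum>u\<in>C. mean T u - mean S u)"
  proof (rule sum_mono)
    show "1 - (if u \<in> J then g u else 0) \<le> mean T u - mean S u" if "u \<in> C" for u
      using mean_T[OF that] mean_S[OF that] by (cases "u \<in> J") (simp_all add: g_def)
  qed
  \<comment> \<open>The extra terms for \<open>t\<close> in \<open>T\<close> and \<open>s\<close> in
    \<open>S\<close> cancel by \<open>same\<close>.\<close>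
  also have "\<dots> = (\<Sum>u\<in>T. mean T u) - (\<Sum>u\<in>S. mean S u)"
    using SC TC finC same by (simp add: sum_subtractf)
  finally have "(real (card C) - \<Sigma>) / k
      \<le> measure_pmf.expectation (?P T) ?F - measure_pmf.expectation (?P S) ?F"
    by (simp add: expect divide_right_mono flip: diff_divide_distrib)
  also have "\<dots> \<le> wasserstein ?D (?P S) (?P T)"
  proof (rule wasserstein_ge_potential)
    have sub: "set_pmf (?P S) \<subseteq> \<B>" "set_pmf (?P T) \<subseteq> \<B>"
      using set_pmf_exchange_walk S T SC TC by auto
    then show "finite (set_pmf (?P S))" "finite (set_pmf (?P T))"
      using finite_bases finite_subset by blast+
    show "?F Y - ?F X \<le> ?D X Y" if "X \<in> set_pmf (?P S)" "Y \<in> set_pmf (?P T)" for X Y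
      using potential_lipschitz[OF rank] that sub by blast
  qed
  finally have W: "(real (card C) - \<Sigma>) / k \<le> wasserstein ?D (?P S) (?P T)" .
  have "ollivier_ricci_curvature \<B> \<le> 1 - wasserstein ?D (?P S) (?P T)"
    using curvature_le[OF S T] st SC dist by auto
  also have "\<dots> \<le> 1 - (real (card C) - \<Sigma>) / k" using W by simp
  \<comment> \<open>As \<open>C\<close> has \<open>k - 1\<close> elements,
    \<open>1 - card C / k\<close> is \<open>1 / k\<close>.\<close>
  also have "\<dots> = 1 / real k + 1 / real k * \<Sigma>"
    using k by (simp add: field_simps)
  finally show ?thesis unfolding \<Sigma>_def g_def .
qed

end
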